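(* Let $0\le\alpha\le1$ and let $G$ be a connected graph of order $n$ having Wiener index $W(G)$. Then $$D_\alpha S(G)\ge \frac{2}{n}\sqrt{n\left(2(1-\alpha)^2\sum_{1\le i<j\le n}(d_{ij})^2+\alpha^2\sum_{i=1}^n Tr_i^2\right)-4\alpha^2W^2(G)}.$$
   Context: All graphs are finite, undirected and simple. For a connected graph $G$ with vertices $v_1,\dots,v_n$, $d_{ij}$ is the distance between $v_i$ and $v_j$, $D(G)=(d_{ij})$ is the distance matrix, $Tr_i=\sum_{j}d_{ij}$ is the transmission of $v_i$, $Tr(G)=\mathrm{diag}(Tr_1,\dots,Tr_n)$, and $W(G)=\frac12\sum_i Tr_i$ is the Wiener index. For $0\le\alpha\le1$ the generalized distance matrix is $D_\alpha(G)=\alpha Tr(G)+(1-\alpha)D(G)$, with eigenvalues $\partial_1\ge\partial_2\ge\cdots\ge\partial_n$. The generalized distance spectral spread is $D_\alpha S(G)=\partial_1-\partial_n$. *)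

theory Defs
  imports
    "HOL-Library.Multiset"
    "Graph_Theory.Digraph_Component"
    "Graph_Theory.Shortest_Path"
    "Jordan_Normal_Form.Char_Poly"
begin

(* Graphs are those of the locale graph of Graph_Theory.Digraph: finite, loop-free digraphs
   without parallel arcs and with symmetric adjacency. The vertices are enumerated as
   v 1, ..., v n, whereas matrices are indexed from 0, hence the successors in the matrix
   definitions below. *)

(* Length of a shortest walk, i.e. the minimal cost of a walk when every arc has weight 1.
   real_of_ereal sends the infinite distance of a disconnected pair to 0; this case does not
   arise in a connected graph. *)
definition graph_dist :: "('a, 'b) pre_digraph \<Rightarrow> 'a \<Rightarrow> 'a \<Rightarrow> real" where
  "graph_dist G x y = real_of_ereal (wf_digraph.\<mu> G (\<lambda>_. 1) x y)"

definition distance_mat :: "('a, 'b) pre_digraph \<Rightarrow> nat \<Rightarrow> (nat \<Rightarrow> 'a) \<Rightarrow> real mat" where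
  "distance_mat G n v = mat n n (\<lambda>(i, j). graph_dist G (v (Suc i)) (v (Suc j)))"

definition transmission :: "('a, 'b) pre_digraph \<Rightarrow> 'a \<Rightarrow> real" where
  "transmission G x = (\<Sum>y\<in>verts G. graph_dist G x y)"

definition transmission_mat :: "('a, 'b) pre_digraph \<Rightarrow> nat \<Rightarrow> (nat \<Rightarrow> 'a) \<Rightarrow> real mat" where
  "transmission_mat G n v =
     mat n n (\<lambda>(i, j). if i = j then transmission G (v (Suc i)) else 0)"

definition wiener_index :: "('a, 'b) pre_digraph \<Rightarrow> real" where
  "wiener_index G = 1 / 2 * (\<Sum>x\<in>verts G. transmission G x)"

definition gen_distance_mat ::
    "real \<Rightarrow> ('a, 'b) pre_digraph \<Rightarrow> nat \<Rightarrow> (nat \<Rightarrow> 'a) \<Rightarrow> real mat" where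
  "gen_distance_mat \<alpha> G n v =
     \<alpha> \<cdot>\<^sub>m transmission_mat G n v + (1 - \<alpha>) \<cdot>\<^sub>m distance_mat G n v"

(* nth_eigenvalue A i is the i-th largest real eigenvalue (i = 1, 2, ...), counted with
   algebraic multiplicity. A real symmetric matrix of order n has exactly n of them. *)
definition nth_eigenvalue :: "real mat \<Rightarrow> nat \<Rightarrow> real" where
  "nth_eigenvalue A i = rev (sorted_list_of_multiset (proots (char_poly A))) ! (i - 1)"

definition gen_distance_spread ::
    "real \<Rightarrow> ('a, 'b) pre_digraph \<Rightarrow> nat \<Rightarrow> (nat \<Rightarrow> 'a) \<Rightarrow> real" where
  "gen_distance_spread \<alpha> G n v =
     nth_eigenvalue (gen_distance_mat \<alpha> G n v) 1 - nth_eigenvalue (gen_distance_mat \<alpha> G n v) n"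

end

theory Submission
  imports Defs "Jordan_Normal_Form.Schur_Decomposition"
begin

text \<open>The right-hand side is twice the standard deviation of the eigenvalues: their sum is the trace
  \<open>2 * \<alpha> * W\<close>, and the sum of their squares is the trace of the squared matrix, i.e. the sum of the
  squares of its entries. By Popoviciu's inequality, the standard deviation of a list of reals is at
  most half its range.\<close>

section \<open>Traces of a matrix and of its square in terms of eigenvalues\<close>

definition mat_trace :: "'a :: comm_ring_1 mat \<Rightarrow> 'a" where
  "mat_trace A = (\<Sum>i<dim_row A. A $$ (i, i))"

lemma mat_trace_diag: "A \<in> carrier_mat n n \<Longrightarrow> mat_trace A = sum_list (diag_mat A)"
  by (auto simp: mat_trace_def diag_mat_def sum_list_distinct_conv_sum_set atLeast0LessThan)

lemma mat_trace_mult: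
  assumes "A \<in> carrier_mat n m" "B \<in> carrier_mat m n"
  shows "mat_trace (A * B) = (\<Sum>i<n. \<Sum>j<m. A $$ (i, j) * B $$ (j, i))"
  using assms by (auto simp: mat_trace_def scalar_prod_def atLeast0LessThan intro!: sum.cong)

lemma mat_trace_comm:
  assumes "A \<in> carrier_mat n m" "B \<in> carrier_mat m n"
  shows "mat_trace (A * B) = mat_trace (B * A)"
  unfolding mat_trace_mult[OF assms] mat_trace_mult[OF assms(2,1)]
  by (subst sum.swap) (simp add: mult.commute)

text \<open>Write \<open>A = P * B * Q\<close> with \<open>Q * P = 1\<close>. Commuting
  \<open>Q\<close> to the front under the trace cancels both factors.\<close>

lemma mat_trace_similar:
  assumes "similar_mat A B"
  shows "mat_trace A = mat_trace B"
proof -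
  from similar_matD[OF assms] obtain n P Q
    where c: "P \<in> carrier_mat n n" "B \<in> carrier_mat n n" "Q \<in> carrier_mat n n"
      and QP: "Q * P = 1\<^sub>m n" and A: "A = P * B * Q" by auto
  have "mat_trace A = mat_trace (Q * (P * B))"
    unfolding A using c by (intro mat_trace_comm) auto
  also have "Q * (P * B) = Q * P * B" using c by (intro assoc_mult_mat[symmetric]) auto
  finally show ?thesis using c QP by simp
qed

lemma similar_mat_square:
  assumes "similar_mat A B"
  shows "similar_mat (A * A) (B * B)"
proof -
  from assms obtain P Q where w: "similar_mat_wit A B P Q" by (auto simp: similar_mat_def)
  hence "similar_mat_wit (A ^\<^sub>m 2) (B ^\<^sub>m 2) P Q" by (rule similar_mat_wit_pow)
  moreover have "M ^\<^sub>m 2 = M * M" if "M \<in> carrier_mat k k" for M :: "'a mat" and k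
    using that by (simp add: numeral_2_eq_2)
  ultimately show ?thesis
    using similar_mat_witD[OF refl w] unfolding similar_mat_def by metis
qed

lemma upper_triangular_square_diag:
  fixes B :: "'a :: comm_ring_1 mat"
  assumes B: "B \<in> carrier_mat n n" and ut: "upper_triangular B"
  shows "diag_mat (B * B) = map (\<lambda>x. x\<^sup>2) (diag_mat B)"
proof (rule nth_equalityI)
  fix i assume "i < length (diag_mat (B * B))"
  hence i: "i < n" using B by (simp add: diag_mat_def)
  \<comment> \<open>Off the diagonal, one of \<open>(i, j)\<close> and \<open>(j, i)\<close> lies
    below it, where \<open>B\<close> vanishes.\<close>
  have z: "B $$ (i, j) * B $$ (j, i) = 0" if "j < n" "j \<noteq> i" for j
    using that i upper_triangularD[OF ut, of j i] upper_triangularD[OF ut, of i j] B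
    by (cases "j < i") auto
  have "(B * B) $$ (i, i) = (\<Sum>j<n. B $$ (i, j) * B $$ (j, i))"
    using B i by (auto simp: scalar_prod_def atLeast0LessThan)
  also have "\<dots> = (\<Sum>j\<in>{i}. B $$ (i, j) * B $$ (j, i))"
    using i z by (intro sum.mono_neutral_right) auto
  finally show "diag_mat (B * B) ! i = map (\<lambda>x. x\<^sup>2) (diag_mat B) ! i"
    using B i by (simp add: diag_mat_def power2_eq_square)
qed (use B in \<open>simp add: diag_mat_def\<close>)

text \<open>Schur decomposition makes \<open>A\<close> similar to an upper triangular matrix with
  diagonal \<open>es\<close>. The trace is a similarity invariant, and squaring that matrix squares
  its diagonal entries.\<close>

lemma mat_trace_eigenvalues:
  fixes A :: "'a :: conjugatable_ordered_field mat"
  assumes A: "A \<in> carrier_mat n n" and c: "char_poly A = (\<Prod>e\<leftarrow>es. [:- e, 1:])"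
  shows "mat_trace A = sum_list es" and "mat_trace (A * A) = (\<Sum>e\<leftarrow>es. e\<^sup>2)"
proof -
  obtain B P Q where "schur_decomposition A es = (B, P, Q)"
    by (cases "schur_decomposition A es") auto
  from schur_decomposition[OF A c this]
  have w: "similar_mat_wit A B P Q" and ut: "upper_triangular B" and d: "diag_mat B = es" by auto
  from similar_mat_witD2[OF A w] have B: "B \<in> carrier_mat n n" by auto
  from w have sim: "similar_mat A B" by (auto simp: similar_mat_def)
  show "mat_trace A = sum_list es"
    using mat_trace_similar[OF sim] mat_trace_diag[OF B] d by simp
  have BB: "B * B \<in> carrier_mat n n" using B by simp
  show "mat_trace (A * A) = (\<Sum>e\<leftarrow>es. e\<^sup>2)"
    using mat_trace_similar[OF similar_mat_square[OF sim]] mat_trace_diag[OF BB]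
      upper_triangular_square_diag[OF B ut] d by simp
qed

section \<open>Real spectrum of symmetric matrices\<close>

text \<open>The Hermitian form \<open>q\<close> of \<open>A\<close> at \<open>v\<close> equals
  \<open>e\<close> times the squared norm \<open>s\<close> of \<open>v\<close>. Symmetry gives
  \<open>cnj q = q\<close>, and \<open>s\<close> is nonzero, so \<open>e\<close> equals its
  conjugate.\<close>

lemma symmetric_eigenvalue_real:
  fixes A :: "real mat"
  assumes A: "A \<in> carrier_mat n n"
    and sym: "\<And>i j. i < n \<Longrightarrow> j < n \<Longrightarrow> A $$ (i, j) = A $$ (j, i)"
    and ev: "eigenvector (map_mat complex_of_real A) v e"
  shows "e \<in> \<real>"
proof -
  let ?a = "\<lambda>i j. complex_of_real (A $$ (i, j))"
  from ev A have v: "dim_vec v = n" "v \<in> carrier_vec n" and v0: "v \<noteq> 0\<^sub>v n"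
    and Av: "map_mat complex_of_real A *\<^sub>v v = e \<cdot>\<^sub>v v"
    by (auto simp: eigenvector_def)
  have row: "(\<Sum>j<n. ?a i j * v $ j) = e * v $ i" if "i < n" for i
  proof -
    have "(map_mat complex_of_real A *\<^sub>v v) $ i = (\<Sum>j<n. ?a i j * v $ j)"
      using that A v by (auto simp: scalar_prod_def atLeast0LessThan)
    thus ?thesis using Av that v by simp
  qed
  define q where "q = (\<Sum>i<n. \<Sum>j<n. cnj (v $ i) * ?a i j * v $ j)"
  define s where "s = (\<Sum>i<n. (cmod (v $ i))\<^sup>2)"
  have "q = (\<Sum>i<n. cnj (v $ i) * (\<Sum>j<n. ?a i j * v $ j))"
    unfolding q_def by (simp add: sum_distrib_left mult.assoc)
  also have "\<dots> = (\<Sum>i<n. cnj (v $ i) * (e * v $ i))"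
    by (intro sum.cong refl arg_cong2[where f = "(*)"] row) auto
  also have "\<dots> = e * complex_of_real s"
    unfolding s_def of_real_sum sum_distrib_left
    by (intro sum.cong refl) (simp add: complex_norm_square mult_ac del: of_real_power)
  finally have q: "q = e * complex_of_real s" .
  have "cnj q = (\<Sum>i<n. \<Sum>j<n. cnj (v $ j) * ?a i j * v $ i)"
    by (simp add: q_def mult_ac)
  also have "\<dots> = (\<Sum>j<n. \<Sum>i<n. cnj (v $ j) * ?a i j * v $ i)"
    by (rule sum.swap)
  also have "\<dots> = q" unfolding q_def by (intro sum.cong refl) (auto simp: sym)
  finally have "cnj e * complex_of_real s = e * complex_of_real s" using q by simp
  moreover have "s \<noteq> 0"
  proof
    assume "s = 0"
    hence "\<forall>i\<in>{..<n}. (cmod (v $ i))\<^sup>2 = 0"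
      unfolding s_def by (subst (asm) sum_nonneg_eq_0_iff) auto
    with v v0 show False by (auto simp: vec_eq_iff)
  qed
  ultimately show ?thesis by (simp add: Reals_cnj_iff)
qed

text \<open>The characteristic polynomial splits over the complex numbers. Its roots are
  eigenvalues, hence real, and injectivity of \<open>map_poly complex_of_real\<close> brings the
  factorization back to the reals.\<close>

lemma symmetric_char_poly_factorized:
  fixes A :: "real mat"
  assumes A: "A \<in> carrier_mat n n"
    and sym: "\<And>i j. i < n \<Longrightarrow> j < n \<Longrightarrow> A $$ (i, j) = A $$ (j, i)"
  shows "\<exists>es. char_poly A = (\<Prod>e\<leftarrow>es. [:- e, 1:]) \<and> length es = n"
proof -
  let ?C = "map_mat complex_of_real A"
  have C: "?C \<in> carrier_mat n n" using A by simp
  from char_poly_factorized[OF C] obtain as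
    where as: "char_poly ?C = (\<Prod>a\<leftarrow>as. [:- a, 1:])" "length as = n" by auto
  have real: "complex_of_real (Re a) = a" if "a \<in> set as" for a
  proof -
    have "poly (char_poly ?C) a = 0"
      using that by (auto simp: as poly_prod_list prod_list_zero_iff)
    then obtain v where "eigenvector ?C v a"
      using eigenvalue_root_char_poly[OF C] by (auto simp: eigenvalue_def)
    thus ?thesis using symmetric_eigenvalue_real[OF A sym] by simp
  qed
  interpret h: map_poly_inj_idom_hom complex_of_real ..
  have "map_poly complex_of_real (char_poly A) = (\<Prod>a\<leftarrow>as. [:- a, 1:])"
    unfolding as(1)[symmetric] by (rule of_real_hom.char_poly_hom[OF A, symmetric])
  also have "map (\<lambda>a. [:- a, 1:]) as =
      map (map_poly complex_of_real) (map (\<lambda>e. [:- e, 1:]) (map Re as))"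
    using real by simp
  also have "prod_list \<dots> = map_poly complex_of_real (\<Prod>e\<leftarrow>map Re as. [:- e, 1:])"
    by (simp only: h.hom_prod_list)
  finally have "char_poly A = (\<Prod>e\<leftarrow>map Re as. [:- e, 1:])"
    by (simp only: h.eq_iff)
  thus ?thesis using as by (intro exI[of _ "map Re as"]) simp
qed

section \<open>Spread of a symmetric matrix\<close>

text \<open>Links \<open>nth_eigenvalue\<close>, which is defined through \<open>proots\<close>, to
  the list \<open>es\<close> of a factorization.\<close>

lemma proots_linear_factors:
  "proots (\<Prod>e\<leftarrow>es. [:- e, 1:]) = mset (es :: 'a :: idom list)"
proof (induction es)
  case (Cons e es)
  have "(\<Prod>e\<leftarrow>es. [:- e, 1:]) \<noteq> 0" by (auto simp: prod_list_zero_iff)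
  thus ?case using Cons by (simp add: proots_mult del: mult_pCons_left)
qed simp

text \<open>Sum \<open>(x - m) * (M - x) \<ge> 0\<close> over the list and complete the square.\<close>

lemma popoviciu:
  fixes xs :: "real list"
  assumes "\<And>x. x \<in> set xs \<Longrightarrow> m \<le> x \<and> x \<le> M"
  shows "4 * (real (length xs) * (\<Sum>x\<leftarrow>xs. x\<^sup>2) - (sum_list xs)\<^sup>2) \<le> (real (length xs) * (M - m))\<^sup>2"
proof -
  define k s q where "k = real (length xs)" and "s = sum_list xs" and "q = (\<Sum>x\<leftarrow>xs. x\<^sup>2)"
  have "q \<le> (M + m) * s - k * (m * M)"
    using assms unfolding k_def s_def q_def
  proof (induction xs)
    case (Cons x xs)
    have "0 \<le> (x - m) * (M - x)" using Cons.prems by simp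
    moreover have "(\<Sum>x\<leftarrow>xs. x\<^sup>2) \<le> (M + m) * sum_list xs - real (length xs) * (m * M)"
      using Cons by simp
    ultimately show ?case by (simp add: algebra_simps power2_eq_square)
  qed simp
  hence "k * q \<le> k * ((M + m) * s - k * (m * M))"
    by (intro mult_left_mono) (simp_all add: k_def)
  hence "4 * (k * q - s\<^sup>2) \<le> 4 * (k * ((M + m) * s - k * (m * M)) - s\<^sup>2)"
    by simp
  also have "\<dots> = (k * (M - m))\<^sup>2 - (2 * s - k * (M + m))\<^sup>2"
    by (simp add: algebra_simps power2_eq_square)
  also have "\<dots> \<le> (k * (M - m))\<^sup>2" by simp
  finally show ?thesis by (simp only: k_def s_def q_def)
qed

text \<open>Popoviciu's inequality is applied to the list of eigenvalues, with the smallest and the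
  largest eigenvalue as bounds; the traces of \<open>A\<close> and \<open>A * A\<close> supply its
  two sums.\<close>

lemma symmetric_spread_ge:
  fixes A :: "real mat"
  assumes A: "A \<in> carrier_mat n n" and n: "n > 0"
    and sym: "\<And>i j. i < n \<Longrightarrow> j < n \<Longrightarrow> A $$ (i, j) = A $$ (j, i)"
  shows "nth_eigenvalue A 1 - nth_eigenvalue A n \<ge>
    2 / real n * sqrt (real n * (\<Sum>i<n. \<Sum>j<n. (A $$ (i, j))\<^sup>2) - (\<Sum>i<n. A $$ (i, i))\<^sup>2)"
proof -
  from symmetric_char_poly_factorized[OF A sym] obtain es
    where c: "char_poly A = (\<Prod>e\<leftarrow>es. [:- e, 1:])" and l: "length es = n" by auto
  define M m where "M = nth_eigenvalue A 1" and "m = nth_eigenvalue A n"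
  \<comment> \<open>The definition reverses an ascending list, so the indices 1 and \<open>n\<close>
    become the positions \<open>n - 1\<close> and 0 of \<open>sort es\<close>.\<close>
  have M: "M = sort es ! (n - 1)" and m: "m = sort es ! 0"
    using l n by (simp_all add: M_def m_def nth_eigenvalue_def c proots_linear_factors rev_nth)
  have bd: "m \<le> x \<and> x \<le> M" if x: "x \<in> set es" for x
  proof -
    from x have "x \<in> set (sort es)" by simp
    then obtain i where "i < n" "x = sort es ! i"
      unfolding in_set_conv_nth using l by (metis length_sort)
    thus ?thesis unfolding M m using l by (auto intro!: sorted_nth_mono)
  qed
  have mM: "m \<le> M" unfolding M m using l n by (auto intro!: sorted_nth_mono)
  have "(\<Sum>i<n. \<Sum>j<n. (A $$ (i, j))\<^sup>2) = mat_trace (A * A)"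
    unfolding mat_trace_mult[OF A A] by (intro sum.cong refl) (auto simp: sym power2_eq_square)
  also have "\<dots> = (\<Sum>e\<leftarrow>es. e\<^sup>2)" by (rule mat_trace_eigenvalues[OF A c])
  finally have q: "(\<Sum>i<n. \<Sum>j<n. (A $$ (i, j))\<^sup>2) = (\<Sum>e\<leftarrow>es. e\<^sup>2)" .
  have s: "(\<Sum>i<n. A $$ (i, i)) = sum_list es"
    using mat_trace_eigenvalues(1)[OF A c] A by (simp add: mat_trace_def)
  have "real n * (\<Sum>e\<leftarrow>es. e\<^sup>2) - (sum_list es)\<^sup>2 \<le> (real n * (M - m) / 2)\<^sup>2"
    using popoviciu[of es m M] bd l by (simp add: power_divide)
  \<comment> \<open>Taking roots requires a nonnegative right-hand side, which \<open>mM\<close>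
    provides.\<close>
  hence "sqrt (real n * (\<Sum>e\<leftarrow>es. e\<^sup>2) - (sum_list es)\<^sup>2) \<le> real n * (M - m) / 2"
    using mM by (intro real_le_lsqrt) auto
  thus ?thesis
    unfolding q s M_def[symmetric] m_def[symmetric] using n by (simp add: field_simps)
qed

section \<open>Symmetry and zero diagonal of the distance\<close>

text \<open>Each arc is replaced by one in the opposite direction. Keeping the length preserves the
  cost under unit weights.\<close>

lemma (in sym_digraph) awalk_reverse:
  assumes "awalk u p v"
  shows "\<exists>q. awalk v q u \<and> length q = length p"
  using assms
proof (induction p arbitrary: u)
  case Nil
  thus ?case by (intro exI[of _ "[]"]) (auto simp: awalk_Nil_iff)
next
  case (Cons e p)
  hence e: "e \<in> arcs G" "u = tail G e" and p: "awalk (head G e) p v"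
    by (auto simp: awalk_Cons_iff)
  from Cons.IH[OF p] obtain q where q: "awalk v q (head G e)" "length q = length p" by auto
  from sym_arcs e obtain e' where e': "e' \<in> arcs G" "tail G e' = head G e" "head G e' = u"
    unfolding symmetric_conv by metis
  hence "awalk (head G e) [e'] u" by (auto simp: awalk_Cons_iff awalk_Nil_iff)
  with q have "awalk v (q @ [e']) u" by (auto intro: awalk_appendI)
  with q show ?case by (intro exI[of _ "q @ [e']"]) simp
qed

lemma (in wf_digraph) awalk_cost_one: "awalk_cost (\<lambda>_. 1) p = real (length p)"
  by (induction p) auto

lemma (in sym_digraph) graph_dist_commute: "graph_dist G u v = graph_dist G v u"
proof -
  \<comment> \<open>Stated for all \<open>x\<close> and \<open>y\<close>, so that both inclusions
    between the cost sets follow; the distances are the infima of these sets.\<close>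
  have "(\<lambda>p. ereal (awalk_cost (\<lambda>_. 1) p)) ` {p. awalk x p y} \<subseteq>
      (\<lambda>p. ereal (awalk_cost (\<lambda>_. 1) p)) ` {p. awalk y p x}" for x y
    using awalk_reverse[of x _ y] by (fastforce simp: awalk_cost_one image_iff)
  hence "(\<lambda>p. ereal (awalk_cost (\<lambda>_. 1) p)) ` {p. awalk u p v} =
      (\<lambda>p. ereal (awalk_cost (\<lambda>_. 1) p)) ` {p. awalk v p u}"
    by (intro antisym)
  thus ?thesis by (simp add: graph_dist_def \<mu>_def)
qed

text \<open>The empty walk at \<open>u\<close> costs 0, and no walk has negative cost under unit
  weights.\<close>

lemma (in wf_digraph) graph_dist_self:
  assumes "u \<in> verts G"
  shows "graph_dist G u u = 0"
proof -
  have "\<mu> (\<lambda>_. 1) u u \<le> 0"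
    using min_cost_le_walk_cost[of u "[]" u "\<lambda>_. 1"] assms
    by (simp add: awalk_Nil_iff zero_ereal_def)
  moreover have "\<mu> (\<lambda>_. 1) u u \<ge> 0"
    unfolding \<mu>_def by (intro INF_greatest) (simp add: awalk_cost_one)
  ultimately show ?thesis by (simp add: graph_dist_def)
qed

section \<open>Sums over pairs and the final bound\<close>

text \<open>The index square splits into two triangles, exchanged by \<open>prod.swap\<close>, and
  the diagonal, which contributes 0.\<close>

lemma sum_symmetric_zero_diag:
  fixes f :: "nat \<Rightarrow> nat \<Rightarrow> 'a :: comm_semiring_1"
  assumes sym: "\<And>i j. i \<in> {1..n} \<Longrightarrow> j \<in> {1..n} \<Longrightarrow> f i j = f j i"
    and diag: "\<And>i. i \<in> {1..n} \<Longrightarrow> f i i = 0"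
  shows "(\<Sum>i = 1..n. \<Sum>j = 1..n. f i j) =
    2 * (\<Sum>(i, j) \<in> {(i, j). 1 \<le> i \<and> i < j \<and> j \<le> n}. f i j)"
proof -
  let ?U = "{(i, j). 1 \<le> i \<and> i < j \<and> j \<le> n}"
  let ?L = "{(i, j). 1 \<le> j \<and> j < i \<and> i \<le> n}"
  let ?D = "{(i, j). 1 \<le> i \<and> i = j \<and> j \<le> n}"
  have fin: "finite ?U" "finite ?L" "finite ?D"
    by (rule finite_subset[of _ "{1..n} \<times> {1..n}"]; auto)+
  have split: "{1..n} \<times> {1..n} = (?U \<union> ?L) \<union> ?D" by auto
  have "(\<Sum>i = 1..n. \<Sum>j = 1..n. f i j) = (\<Sum>(i, j) \<in> {1..n} \<times> {1..n}. f i j)"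
    by (rule sum.cartesian_product)
  also have "\<dots> = (\<Sum>(i, j)\<in>?U \<union> ?L. f i j) + (\<Sum>(i, j)\<in>?D. f i j)"
    unfolding split using fin by (intro sum.union_disjoint) auto
  also have "(\<Sum>(i, j)\<in>?U \<union> ?L. f i j) = (\<Sum>(i, j)\<in>?U. f i j) + (\<Sum>(i, j)\<in>?L. f i j)"
    using fin by (intro sum.union_disjoint) auto
  also have "(\<Sum>(i, j)\<in>?L. f i j) = (\<Sum>(i, j)\<in>?U. f i j)"
    by (rule sum.reindex_bij_witness[of _ prod.swap prod.swap]) (auto simp: sym)
  also have "(\<Sum>(i, j)\<in>?D. f i j) = 0"
    by (intro sum.neutral) (auto simp: diag)
  finally show ?thesis by (simp add: mult_2)
qed

theorem theorem2p8:
  fixes \<alpha> :: real and G :: "('a, 'b) pre_digraph" and n :: nat and v :: "nat \<Rightarrow> 'a"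
  assumes "0 \<le> \<alpha>" and "\<alpha> \<le> 1"
    and "graph G" and "connected G" and "card (verts G) = n"
    and "bij_betw v {1..n} (verts G)"
  shows "gen_distance_spread \<alpha> G n v \<ge>
    2 / real n * sqrt (real n *
        (2 * (1 - \<alpha>)\<^sup>2 * (\<Sum>(i, j) \<in> {(i, j). 1 \<le> i \<and> i < j \<and> j \<le> n}. (graph_dist G (v i) (v j))\<^sup>2)
          + \<alpha>\<^sup>2 * (\<Sum>i = 1..n. (transmission G (v i))\<^sup>2))
      - 4 * \<alpha>\<^sup>2 * (wiener_index G)\<^sup>2)"
proof -
  interpret graph G by fact
  let ?d = "\<lambda>i j. graph_dist G (v i) (v j)" and ?t = "\<lambda>i. transmission G (v i)"
  let ?A = "gen_distance_mat \<alpha> G n v"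
  \<comment> \<open>Connectedness includes having at least one vertex.\<close>
  have "verts G \<noteq> {}"
    using \<open>connected G\<close> by (auto simp: connected_def strongly_connected_def)
  hence n: "n > 0" using assms(5) by (auto simp: card_gt_0_iff)
  have verts: "v i \<in> verts G" if "i \<in> {1..n}" for i
    using assms(6) that by (auto simp: bij_betw_def)
  have A: "?A \<in> carrier_mat n n"
    by (simp add: gen_distance_mat_def distance_mat_def transmission_mat_def)
  have entry: "?A $$ (i, j) =
      (if i = j then \<alpha> * ?t (Suc i) else (1 - \<alpha>) * ?d (Suc i) (Suc j))"
    if "i < n" "j < n" for i j
    using that verts
    by (auto simp: gen_distance_mat_def distance_mat_def transmission_mat_def graph_dist_self)
  have sym: "?A $$ (i, j) = ?A $$ (j, i)" if "i < n" "j < n" for i j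
    using that by (simp add: entry graph_dist_commute)
  have "(\<Sum>i<n. ?A $$ (i, i)) = \<alpha> * (\<Sum>i = 1..n. ?t i)"
    by (simp add: entry sum_distrib_left sum.atLeast1_atMost_eq)
  \<comment> \<open>Reindexing along \<open>v\<close> gives the vertex sum in
    \<open>wiener_index\<close>, which is twice the index.\<close>
  also have "(\<Sum>i = 1..n. ?t i) = (\<Sum>x\<in>verts G. transmission G x)"
    by (rule sum.reindex_bij_betw[OF assms(6)])
  finally have tr: "(\<Sum>i<n. ?A $$ (i, i)) = 2 * \<alpha> * wiener_index G"
    by (simp add: wiener_index_def)
  \<comment> \<open>No cross terms arise: the transmission part lives on the diagonal, where the
    distances are 0.\<close>
  have "(\<Sum>i<n. \<Sum>j<n. (?A $$ (i, j))\<^sup>2) =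
      (\<Sum>i<n. \<Sum>j<n. (if i = j then \<alpha>\<^sup>2 * (?t (Suc i))\<^sup>2 else 0) +
        (1 - \<alpha>)\<^sup>2 * (?d (Suc i) (Suc j))\<^sup>2)"
    using verts by (intro sum.cong refl) (auto simp: entry power_mult_distrib graph_dist_self)
  also have "\<dots> = (\<Sum>i<n. \<alpha>\<^sup>2 * (?t (Suc i))\<^sup>2) +
      (\<Sum>i<n. \<Sum>j<n. (1 - \<alpha>)\<^sup>2 * (?d (Suc i) (Suc j))\<^sup>2)"
    by (simp add: sum.distrib)
  also have "\<dots> = \<alpha>\<^sup>2 * (\<Sum>i = 1..n. (?t i)\<^sup>2) +
      (1 - \<alpha>)\<^sup>2 * (\<Sum>i = 1..n. \<Sum>j = 1..n. (?d i j)\<^sup>2)"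
    by (simp add: sum_distrib_left sum.atLeast1_atMost_eq)
  also have "(\<Sum>i = 1..n. \<Sum>j = 1..n. (?d i j)\<^sup>2) =
      2 * (\<Sum>(i, j) \<in> {(i, j). 1 \<le> i \<and> i < j \<and> j \<le> n}. (?d i j)\<^sup>2)"
    using verts by (intro sum_symmetric_zero_diag) (auto simp: graph_dist_commute graph_dist_self)
  finally have sq: "(\<Sum>i<n. \<Sum>j<n. (?A $$ (i, j))\<^sup>2) =
      2 * (1 - \<alpha>)\<^sup>2 * (\<Sum>(i, j) \<in> {(i, j). 1 \<le> i \<and> i < j \<and> j \<le> n}. (?d i j)\<^sup>2) +
      \<alpha>\<^sup>2 * (\<Sum>i = 1..n. (?t i)\<^sup>2)"
    by simp
  show ?thesis
    using symmetric_spread_ge[OF A n sym] unfolding sq tr gen_distance_spread_def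
    by (simp add: power_mult_distrib)
qed

end
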